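(* Let $Y^T,Y^C$ be real random variables with finite second moments, $D\in\{0,1\}$ a random variable, and let $X=(I,U,C)$ be a random vector of covariates. Assume: (i) (unconfoundedness) $(Y^T,Y^C)\perp D\mid X$; (ii) (overlap) $0<p(X)<1$ almost surely, where $p(X)=\mathbf{P}(D=1\mid X)$; (iii) $(Y^T,Y^C)\perp I\mid (U,C)$. Let $X_1=(U,C)$, $\beta_T=\mathbf{E}Y^T$, $\beta_C=\mathbf{E}Y^C$. Then the asymptotic variances of the known-propensity-score imputation estimator $\tilde\beta_{imp}$ and of the known-propensity-score IPW estimator $\tilde\beta_{ipw}$ both become larger (weakly) after including $I$ in the covariates, i.e. $$\mathbf{E}\left[\frac{\sigma_T^2(X_1)+\beta_T(X_1)^2}{p(X_1)}+\frac{\sigma_C^2(X_1)+\beta_C(X_1)^2}{1-p(X_1)}\right]\le \mathbf{E}\left[\frac{\sigma_T^2(X)+\beta_T(X)^2}{p(X)}+\frac{\sigma_C^2(X)+\beta_C(X)^2}{1-p(X)}\right],$$ and $$\mathbf{E}\left[\frac{\sigma_T^2(X_1)+(\beta_T(X_1)-\beta_T)^2}{p(X_1)}+\frac{\sigma_C^2(X_1)+(\beta_C(X_1)-\beta_C)^2}{1-p(X_1)}\right]\le \mathbf{E}\left[\frac{\sigma_T^2(X)+(\beta_T(X)-\beta_T)^2}{p(X)}+\frac{\sigma_C^2(X)+(\beta_C(X)-\beta_C)^2}{1-p(X)}\right].$$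
   Context: Notation: $\perp$ denotes (conditional) independence. For a random vector $Z$ of covariates ($Z=X$ or $Z=X_1$): $p(Z)=\mathbf{P}(D=1\mid Z)$, $\beta_T(Z)=\mathbf{E}[Y^T\mid Z]$, $\beta_C(Z)=\mathbf{E}[Y^C\mid Z]$, $\sigma_T^2(Z)=\mathbf{var}(Y^T\mid Z)$, $\sigma_C^2(Z)=\mathbf{var}(Y^C\mid Z)$. With covariates $Z$ and $\beta=\mathbf{E}Y^T-\mathbf{E}Y^C$, the asymptotic variance of $\tilde\beta_{imp}$ is $\mathbf{E}[(\sigma_T^2(Z)+\beta_T(Z)^2)/p(Z)+(\sigma_C^2(Z)+\beta_C(Z)^2)/(1-p(Z))]-\beta^2$ and that of $\tilde\beta_{ipw}$ is $\mathbf{E}[(\sigma_T^2(Z)+(\beta_T(Z)-\beta_T)^2)/p(Z)+(\sigma_C^2(Z)+(\beta_C(Z)-\beta_C)^2)/(1-p(Z))]$; the content of the statement is the two displayed inequalities. Expectations of nonnegative quantities are allowed to take values in $[0,\infty]$. *)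

theory Defs
  imports "HOL-Probability.Probability"
begin

definition sigma_of :: "'w measure \<Rightarrow> ('w \<Rightarrow> 'z::topological_space) \<Rightarrow> 'w measure" where
  "sigma_of M Z = vimage_algebra (space M) Z borel"

text \<open>
  For a random vector \<open>Z\<close>, the quantities \<open>E[Y | Z]\<close>, \<open>P(A | Z)\<close> and \<open>var(Y | Z)\<close> are random
  variables on the underlying space, determined up to null sets. A function of \<open>Z\<close> such as
  \<open>\<beta>(Z) = E[Y | Z]\<close> is represented by this random variable.
\<close>

definition cond_exp_given :: "'w measure \<Rightarrow> ('w \<Rightarrow> 'z::topological_space) \<Rightarrow> ('w \<Rightarrow> real) \<Rightarrow> 'w \<Rightarrow> real" where
  "cond_exp_given M Z Y = real_cond_exp M (sigma_of M Z) Y"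

definition cond_prob_given :: "'w measure \<Rightarrow> ('w \<Rightarrow> 'z::topological_space) \<Rightarrow> 'w set \<Rightarrow> 'w \<Rightarrow> real" where
  "cond_prob_given M Z A = cond_exp_given M Z (indicator A)"

definition cond_var_given :: "'w measure \<Rightarrow> ('w \<Rightarrow> 'z::topological_space) \<Rightarrow> ('w \<Rightarrow> real) \<Rightarrow> 'w \<Rightarrow> real" where
  "cond_var_given M Z Y = cond_exp_given M Z (\<lambda>w. (Y w - cond_exp_given M Z Y w)\<^sup>2)"

definition cond_indep_given ::
  "'w measure \<Rightarrow> ('w \<Rightarrow> 'a::topological_space) \<Rightarrow> ('w \<Rightarrow> 'b::topological_space)
    \<Rightarrow> ('w \<Rightarrow> 'z::topological_space) \<Rightarrow> bool" where
  "cond_indep_given M V W Z \<longleftrightarrow>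
    V \<in> borel_measurable M \<and> W \<in> borel_measurable M \<and> Z \<in> borel_measurable M \<and>
    (\<forall>A\<in>sets borel. \<forall>B\<in>sets borel. AE w in M.
      cond_prob_given M Z {w \<in> space M. V w \<in> A \<and> W w \<in> B} w =
      cond_prob_given M Z {w \<in> space M. V w \<in> A} w * cond_prob_given M Z {w \<in> space M. W w \<in> B} w)"

definition propensity :: "'w measure \<Rightarrow> ('w \<Rightarrow> real) \<Rightarrow> ('w \<Rightarrow> 'z::topological_space) \<Rightarrow> 'w \<Rightarrow> real" where
  "propensity M D Z = cond_prob_given M Z {w \<in> space M. D w = 1}"

end

theory Submission
  imports Defs
begin

text \<open>
  For each arm and each constant \<open>c\<close>, the numerator \<open>\<sigma>\<^sup>2(Z) + (\<beta>(Z) - c)\<^sup>2\<close> is \<open>E[(Y - c)\<^sup>2 | Z]\<close>,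
  and since \<open>Y\<close> is independent of \<open>I\<close> given \<open>X\<^sub>1\<close> it is the same function \<open>g(X\<^sub>1)\<close> for \<open>Z = X\<close> and
  \<open>Z = X\<^sub>1\<close>. Only the denominators differ, and \<open>p(X\<^sub>1) = E[p(X) | X\<^sub>1]\<close>, so Jensen's inequality for
  \<open>x \<mapsto> 1/x\<close> gives \<open>E[g(X\<^sub>1) / p(X\<^sub>1)] \<le> E[g(X\<^sub>1) / p(X)]\<close>; likewise with \<open>1 - p\<close>.
\<close>

section \<open>Sigma-algebras generated by random vectors, and conditional expectations given
  them\<close>

lemma subalgebra_sigma_of:
  assumes "Z \<in> borel_measurable M"
  shows "subalgebra M (sigma_of M Z)"
  unfolding subalgebra_def sigma_of_def
  using sets_image_in_sets[OF refl assms] by simp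

lemma sets_sigma_of: "sets (sigma_of M Z) = {Z -` A \<inter> space M | A. A \<in> sets borel}"
  unfolding sigma_of_def by (rule sets_vimage_algebra2) simp

lemma subalgebra_sigma_of_snd:
  fixes I :: "'w \<Rightarrow> 'i::second_countable_topology" and Z :: "'w \<Rightarrow> 'z::second_countable_topology"
  shows "subalgebra (sigma_of M (\<lambda>w. (I w, Z w))) (sigma_of M Z)"
proof -
  have "snd -` A \<in> sets borel" if "A \<in> sets borel" for A :: "'z set"
    using measurable_sets[OF borel_measurable_continuous_onI[OF continuous_on_snd[OF continuous_on_id]] that]
    by (simp add: id_def)
  moreover have "Z -` A \<inter> space M = (\<lambda>w. (I w, Z w)) -` (snd -` A) \<inter> space M" for A
    by auto
  ultimately show ?thesis
    unfolding subalgebra_def sets_sigma_of by (auto simp: sigma_of_def)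
qed

text \<open>\<open>real_cond_exp\<close> is the difference of the conditional expectations of the
  positive and the negative part, each pushed through \<open>enn2real\<close>. For nonnegative
  \<open>f\<close> the negative part contributes 0, and integrability makes the other conditional
  expectation finite almost everywhere, so \<open>enn2real\<close> loses nothing.\<close>

lemma (in sigma_finite_subalgebra) ennreal_real_cond_exp:
  assumes f: "integrable M f" and nonneg: "AE x in M. 0 \<le> f x"
  shows "AE x in M. ennreal (real_cond_exp M F f x) = nn_cond_exp M F (\<lambda>x. ennreal (f x)) x"
proof -
  have [measurable]: "f \<in> borel_measurable M" using f by simp
  have "(\<integral>\<^sup>+x. nn_cond_exp M F (\<lambda>x. ennreal (f x)) x \<partial>M) = (\<integral>\<^sup>+x. ennreal (f x) \<partial>M)"
    using nn_cond_exp_intg[of "\<lambda>_. 1" "\<lambda>x. ennreal (f x)"] by simp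
  also have "\<dots> < \<infinity>"
    using f nonneg by (simp add: nn_integral_eq_integral)
  finally have fin: "AE x in M. nn_cond_exp M F (\<lambda>x. ennreal (f x)) x \<noteq> \<infinity>"
    by (intro nn_integral_PInf_AE) auto
  have "AE x in M. nn_cond_exp M F (\<lambda>x. ennreal (- f x)) x = nn_cond_exp M F (\<lambda>x. 0) x"
    using nonneg by (intro nn_cond_exp_cong) (auto simp: ennreal_neg)
  moreover have "AE x in M. 0 = nn_cond_exp M F (\<lambda>x. 0) x"
    by (rule nn_cond_exp_F_meas) simp
  ultimately show ?thesis
    using fin unfolding real_cond_exp_def
    by eventually_elim (simp add: less_top)
qed

lemma (in finite_measure) sigma_finite_subalgebra_sigma_of:
  assumes "Z \<in> borel_measurable M"
  shows "sigma_finite_subalgebra M (sigma_of M Z)"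
proof -
  interpret finite_measure_subalgebra M "sigma_of M Z"
    by unfold_locales (rule subalgebra_sigma_of[OF assms])
  show ?thesis by (rule sigma_finite_subalgebra_axioms)
qed

section \<open>Dropping a conditionally independent covariate\<close>

lemma (in prob_space) nn_cond_exp_indicator_inter_of_cond_indep:
  assumes ci: "cond_indep_given M V I Z" and S: "S \<in> sets borel" and B: "B \<in> sets borel"
  shows "AE w in M. nn_cond_exp M (sigma_of M Z) (indicator {w \<in> space M. V w \<in> S \<and> I w \<in> B}) w
    = nn_cond_exp M (sigma_of M Z) (indicator {w \<in> space M. V w \<in> S}) w
      * nn_cond_exp M (sigma_of M Z) (indicator {w \<in> space M. I w \<in> B}) w"
proof -
  have [measurable]: "V \<in> borel_measurable M" "I \<in> borel_measurable M" "Z \<in> borel_measurable M"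
    using ci by (auto simp: cond_indep_given_def)
  note [measurable] = S B
  interpret sigma_finite_subalgebra M "sigma_of M Z"
    by (rule sigma_finite_subalgebra_sigma_of) simp
  \<comment> \<open>Nonnegativity is recorded along with the transfer to \<open>nn_cond_exp\<close>,
    because \<open>ennreal\<close> truncates negative numbers to 0 and can fail to be multiplicative
    on them.\<close>
  have prob: "AE w in M. ennreal (cond_prob_given M Z A w) = nn_cond_exp M (sigma_of M Z) (indicator A) w \<and>
      0 \<le> cond_prob_given M Z A w"
    if [measurable]: "A \<in> sets M" for A
  proof -
    have "AE w in M. ennreal (real_cond_exp M (sigma_of M Z) (indicator A) w)
        = nn_cond_exp M (sigma_of M Z) (\<lambda>w. ennreal (indicator A w)) w"
      by (rule ennreal_real_cond_exp) (auto simp: emeasure_eq_measure)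
    moreover have "AE w in M. 0 \<le> real_cond_exp M (sigma_of M Z) (indicator A) w"
      by (rule real_cond_exp_pos) auto
    ultimately show ?thesis
      unfolding cond_prob_given_def cond_exp_given_def by (simp add: ennreal_indicator)
  qed
  have ci_SB: "AE w in M. cond_prob_given M Z {w \<in> space M. V w \<in> S \<and> I w \<in> B} w =
      cond_prob_given M Z {w \<in> space M. V w \<in> S} w * cond_prob_given M Z {w \<in> space M. I w \<in> B} w"
    using ci S B by (auto simp: cond_indep_given_def)
  have "{w \<in> space M. V w \<in> S \<and> I w \<in> B} \<in> sets M" "{w \<in> space M. V w \<in> S} \<in> sets M"
      "{w \<in> space M. I w \<in> B} \<in> sets M"
    by measurable
  from ci_SB this[THEN prob] show ?thesis
  proof eventually_elim
    case (elim w)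
    then have "ennreal (cond_prob_given M Z {w \<in> space M. V w \<in> S \<and> I w \<in> B} w)
        = ennreal (cond_prob_given M Z {w \<in> space M. V w \<in> S} w)
          * ennreal (cond_prob_given M Z {w \<in> space M. I w \<in> B} w)"
      by (simp only: ennreal_mult)
    then show ?case using elim(2-4) by simp
  qed
qed

text \<open>A Dynkin argument: weighting \<open>M\<close> by the indicator of
  \<open>V \<in> S\<close> or by its conditional expectation given \<open>Z\<close> gives two finite
  measures, whose images under \<open>(I, Z)\<close> agree on rectangles by conditional
  independence. Rectangles are stable under intersection and generate the product sigma-algebra, so
  the images are equal.\<close>

lemma (in prob_space) nn_integral_cond_indep_indicator:
  fixes I :: "'a \<Rightarrow> 'i::second_countable_topology" and Z :: "'a \<Rightarrow> 'z::second_countable_topology"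
  assumes ci: "cond_indep_given M V I Z" and S: "S \<in> sets borel"
    and A: "A \<in> sets (sigma_of M (\<lambda>w. (I w, Z w)))"
  shows "(\<integral>\<^sup>+w. indicator A w * indicator {w \<in> space M. V w \<in> S} w \<partial>M)
    = (\<integral>\<^sup>+w. indicator A w * nn_cond_exp M (sigma_of M Z) (indicator {w \<in> space M. V w \<in> S}) w \<partial>M)"
proof -
  have [measurable]: "V \<in> borel_measurable M" "I \<in> borel_measurable M" "Z \<in> borel_measurable M"
    using ci by (auto simp: cond_indep_given_def)
  note [measurable] = S
  interpret sigma_finite_subalgebra M "sigma_of M Z"
    by (rule sigma_finite_subalgebra_sigma_of) simp
  let ?X = "\<lambda>w. (I w, Z w)" and ?F = "sigma_of M Z"
  let ?V = "{w \<in> space M. V w \<in> S}"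
  let ?h = "nn_cond_exp M ?F (indicator ?V)"
  let ?N1 = "distr (density M (indicator ?V)) (borel \<Otimes>\<^sub>M borel) ?X"
  let ?N2 = "distr (density M ?h) (borel \<Otimes>\<^sub>M borel) ?X"
  let ?E = "{a \<times> b | (a :: 'i set) (b :: 'z set). a \<in> sets borel \<and> b \<in> sets borel}"
  have em: "emeasure (distr (density M f) (borel \<Otimes>\<^sub>M borel) ?X) Q
      = (\<integral>\<^sup>+w. indicator (?X -` Q \<inter> space M) w * f w \<partial>M)"
    if [measurable]: "f \<in> borel_measurable M" "Q \<in> sets (borel \<Otimes>\<^sub>M borel)" for f Q
  proof -
    have "?X -` Q \<inter> space M \<in> sets M" by measurable
    then show ?thesis
      by (simp add: emeasure_distr emeasure_density mult.commute)
  qed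
  have "?N1 = ?N2"
  proof (rule measure_eqI_generator_eq[where \<Omega> = UNIV and E = ?E and A = "\<lambda>_. UNIV"])
    show "Int_stable ?E" by (rule Int_stable_pair_measure_generator)
    show "sets ?N1 = sigma_sets UNIV ?E" "sets ?N2 = sigma_sets UNIV ?E"
      by (simp_all add: sets_pair_measure)
    show "range (\<lambda>_. UNIV) \<subseteq> ?E"
      by (auto intro!: exI[of _ UNIV])
    have "emeasure ?N1 UNIV = (\<integral>\<^sup>+w. indicator (space M) w * indicator ?V w \<partial>M)"
      using em[of "indicator ?V" UNIV] sets.top[of "borel \<Otimes>\<^sub>M borel :: ('i \<times> 'z) measure"] by (simp add: space_pair_measure)
    also have "\<dots> \<le> (\<integral>\<^sup>+w. 1 \<partial>M)"
      by (intro nn_integral_mono) (auto split: split_indicator)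
    also have "\<dots> < \<infinity>" by (simp add: emeasure_space_1)
    finally show "emeasure ?N1 UNIV \<noteq> \<infinity>" by simp
  next
    fix Q assume "Q \<in> ?E"
    then obtain B E where Q: "Q = B \<times> E" and [measurable]: "B \<in> sets borel" "E \<in> sets borel" by auto
    let ?B = "{w \<in> space M. I w \<in> B}" and ?E = "{w \<in> space M. Z w \<in> E}"
    have "?E = Z -` E \<inter> space M" by auto
    then have EF: "?E \<in> sets ?F" using \<open>E \<in> sets borel\<close> unfolding sets_sigma_of by auto
    then have [measurable]: "indicator ?E \<in> borel_measurable ?F" by simp
    have eq: "indicator (?X -` Q \<inter> space M) w = (indicator ?E w * indicator ?B w :: ennreal)" for w
      by (auto simp: Q split: split_indicator)
    have "emeasure ?N1 Q = (\<integral>\<^sup>+w. indicator ?E w * indicator {w \<in> space M. V w \<in> S \<and> I w \<in> B} w \<partial>M)"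
      by (subst em) (auto simp: Q intro!: nn_integral_cong split: split_indicator)
    \<comment> \<open>The event \<open>Z \<in> E\<close> belongs to \<open>?F\<close>, so
      conditioning on \<open>Z\<close> is free here. The conditional probability then factors, and
      since \<open>?h\<close> is also measurable for \<open>?F\<close>, the conditioning on the
      factor of \<open>I \<in> B\<close> can be undone.\<close>
    also have "\<dots> = (\<integral>\<^sup>+w. indicator ?E w * nn_cond_exp M ?F (indicator {w \<in> space M. V w \<in> S \<and> I w \<in> B}) w \<partial>M)"
      by (rule nn_cond_exp_intg[symmetric]) measurable
    also have "\<dots> = (\<integral>\<^sup>+w. indicator ?E w * (?h w * nn_cond_exp M ?F (indicator ?B) w) \<partial>M)"
      using nn_cond_exp_indicator_inter_of_cond_indep[OF ci S \<open>B \<in> sets borel\<close>]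
      by (intro nn_integral_cong_AE) auto
    also have "\<dots> = (\<integral>\<^sup>+w. (indicator ?E w * ?h w) * nn_cond_exp M ?F (indicator ?B) w \<partial>M)"
      by (simp add: mult.assoc)
    also have "\<dots> = (\<integral>\<^sup>+w. (indicator ?E w * ?h w) * indicator ?B w \<partial>M)"
      by (rule nn_cond_exp_intg) measurable
    also have "\<dots> = emeasure ?N2 Q"
      by (subst em) (auto simp: Q intro!: nn_integral_cong split: split_indicator)
    finally show "emeasure ?N1 Q = emeasure ?N2 Q" .
  qed simp_all
  \<comment> \<open>By second countability the Borel sets of the product space form the product
    sigma-algebra, so every event generated by \<open>(I, Z)\<close> is the preimage of a set on
    which \<open>?N1\<close> and \<open>?N2\<close> are compared.\<close>
  moreover obtain Q where "A = ?X -` Q \<inter> space M" "Q \<in> sets (borel \<Otimes>\<^sub>M borel)"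
    using A unfolding sets_sigma_of borel_prod by auto
  ultimately show ?thesis
    using em[of "indicator ?V" Q] em[of ?h Q] by simp
qed

text \<open>Self-adjointness of conditional expectation rewrites the claim on each event \<open>A\<close> as
  \<open>E[1\<^sub>A \<phi>(V)] = E[E[1\<^sub>A | Z] \<phi>(V)]\<close>: two image measures under \<open>V\<close> agree, which need only be
  checked on indicators.\<close>

lemma (in prob_space) nn_cond_exp_drop_cond_indep:
  fixes I :: "'a \<Rightarrow> 'i::second_countable_topology" and Z :: "'a \<Rightarrow> 'z::second_countable_topology"
    and \<phi> :: "'v::topological_space \<Rightarrow> ennreal"
  assumes ci: "cond_indep_given M V I Z" and [measurable]: "\<phi> \<in> borel_measurable borel"
  shows "AE w in M. nn_cond_exp M (sigma_of M (\<lambda>w. (I w, Z w))) (\<lambda>w. \<phi> (V w)) w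
    = nn_cond_exp M (sigma_of M Z) (\<lambda>w. \<phi> (V w)) w"
proof -
  have [measurable]: "V \<in> borel_measurable M" "I \<in> borel_measurable M" "Z \<in> borel_measurable M"
    using ci by (auto simp: cond_indep_given_def)
  let ?F = "sigma_of M (\<lambda>w. (I w, Z w))" and ?G = "sigma_of M Z"
  interpret F: sigma_finite_subalgebra M ?F
    by (rule sigma_finite_subalgebra_sigma_of) simp
  interpret G: sigma_finite_subalgebra M ?G
    by (rule sigma_finite_subalgebra_sigma_of) simp
  have "AE w in M. nn_cond_exp M ?G (\<lambda>w. \<phi> (V w)) w = nn_cond_exp M ?F (\<lambda>w. \<phi> (V w)) w"
  proof (rule F.nn_cond_exp_charact)
    fix A assume A: "A \<in> sets ?F"
    then have [measurable]: "A \<in> sets M" using F.subalg by (auto simp: subalgebra_def)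
    let ?a = "nn_cond_exp M ?G (indicator A)"
    let ?N1 = "distr (density M (indicator A)) borel V" and ?N2 = "distr (density M ?a) borel V"
    \<comment> \<open>Both sides equal the integral of \<open>?a\<close> times the conditional
      expectation of \<open>f\<close>: on each side one factor is already measurable for
      \<open>?G\<close>, so the other may be conditioned.\<close>
    have swap: "(\<integral>\<^sup>+w. indicator A w * nn_cond_exp M ?G f w \<partial>M) = (\<integral>\<^sup>+w. ?a w * f w \<partial>M)"
      if [measurable]: "f \<in> borel_measurable M" for f
      using G.nn_cond_exp_intg[of "nn_cond_exp M ?G f" "indicator A"] G.nn_cond_exp_intg[of ?a f]
      by (simp add: mult.commute)
    have "?N1 = ?N2"
    proof (rule measure_eqI)
      fix S assume "S \<in> sets ?N1"
      then have [measurable]: "S \<in> sets borel" by simp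
      let ?V = "{w \<in> space M. V w \<in> S}"
      have V: "V -` S \<inter> space M = ?V" by auto
      have "emeasure ?N1 S = (\<integral>\<^sup>+w. indicator A w * indicator ?V w \<partial>M)"
        by (simp add: emeasure_distr emeasure_density V)
      also have "\<dots> = (\<integral>\<^sup>+w. indicator A w * nn_cond_exp M ?G (indicator ?V) w \<partial>M)"
        by (rule nn_integral_cond_indep_indicator[OF ci _ A]) simp
      also have "\<dots> = (\<integral>\<^sup>+w. ?a w * indicator ?V w \<partial>M)"
        by (rule swap) simp
      also have "\<dots> = emeasure ?N2 S"
        by (simp add: emeasure_distr emeasure_density V)
      finally show "emeasure ?N1 S = emeasure ?N2 S" .
    qed simp
    then have "(\<integral>\<^sup>+v. \<phi> v \<partial>?N1) = (\<integral>\<^sup>+v. \<phi> v \<partial>?N2)" by simp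
    then have "(\<integral>\<^sup>+w. indicator A w * \<phi> (V w) \<partial>M) = (\<integral>\<^sup>+w. ?a w * \<phi> (V w) \<partial>M)"
      by (simp add: nn_integral_distr nn_integral_density)
    then show "(\<integral>\<^sup>+w\<in>A. \<phi> (V w) \<partial>M) = (\<integral>\<^sup>+w\<in>A. nn_cond_exp M ?G (\<lambda>w. \<phi> (V w)) w \<partial>M)"
      using swap[of "\<lambda>w. \<phi> (V w)"] by (simp add: mult.commute)
  next
    show "nn_cond_exp M ?G (\<lambda>w. \<phi> (V w)) \<in> borel_measurable ?F"
      by (rule measurable_from_subalg[OF subalgebra_sigma_of_snd borel_measurable_nn_cond_exp])
  qed simp
  then show ?thesis by auto
qed

text \<open>The nonnegative version applies separately to the positive and negative parts from which
  \<open>real_cond_exp\<close> is built; this requires no integrability of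
  \<open>\<phi> (V w)\<close>.\<close>

lemma (in prob_space) cond_exp_given_drop_cond_indep:
  fixes I :: "'a \<Rightarrow> 'i::second_countable_topology" and Z :: "'a \<Rightarrow> 'z::second_countable_topology"
    and \<phi> :: "'v::topological_space \<Rightarrow> real"
  assumes ci: "cond_indep_given M V I Z" and [measurable]: "\<phi> \<in> borel_measurable borel"
  shows "AE w in M. cond_exp_given M (\<lambda>w. (I w, Z w)) (\<lambda>w. \<phi> (V w)) w
    = cond_exp_given M Z (\<lambda>w. \<phi> (V w)) w"
  using nn_cond_exp_drop_cond_indep[OF ci, of "\<lambda>v. ennreal (\<phi> v)"]
    nn_cond_exp_drop_cond_indep[OF ci, of "\<lambda>v. ennreal (- \<phi> v)"]
  unfolding cond_exp_given_def real_cond_exp_def by auto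

section \<open>Conditional Jensen inequality for the reciprocal\<close>

text \<open>A conditional Jensen inequality for \<open>x \<mapsto> 1/x\<close> without integrability of \<open>g / q\<close>: the tangent
  bound \<open>2 / e \<le> 1 / q + q / e\<^sup>2\<close> at \<open>e = E[q | F]\<close> is integrated over the sets \<open>g / e \<le> k\<close>, on
  which all terms can be cancelled.\<close>

lemma (in finite_measure_subalgebra) nn_integral_div_cond_exp_le:
  fixes g q :: "'a \<Rightarrow> real"
  assumes [measurable]: "g \<in> borel_measurable F" and g: "AE x in M. 0 \<le> g x"
    and q: "integrable M q" and q_pos: "AE x in M. 0 < q x"
  shows "(\<integral>\<^sup>+x. ennreal (g x / real_cond_exp M F q x) \<partial>M) \<le> (\<integral>\<^sup>+x. ennreal (g x / q x) \<partial>M)"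
proof -
  let ?e = "real_cond_exp M F q"
  let ?N = "\<lambda>k :: nat. {x \<in> space F. g x / ?e x \<le> real k}"
  let ?h = "\<lambda>k x. ennreal (g x / ?e x) * indicator (?N k) x"
  have [measurable]: "q \<in> borel_measurable M" using q by simp
  have gM [measurable]: "g \<in> borel_measurable M" by (rule measurable_from_subalg[OF subalg]) simp
  have e_pos: "AE x in M. 0 < ?e x" using q q_pos by (rule real_cond_exp_gr_c)
  have NF [measurable]: "?N k \<in> sets F" for k by measurable
  have NM [measurable]: "?N k \<in> sets M" for k using NF[of k] subalg by (auto simp: subalgebra_def)
  have bound: "(\<integral>\<^sup>+x. ?h k x \<partial>M) \<le> (\<integral>\<^sup>+x. ennreal (g x / q x) \<partial>M)" for k
  proof -
    have "(\<integral>\<^sup>+x. ?h k x \<partial>M) \<le> (\<integral>\<^sup>+x. ennreal (real k) \<partial>M)"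
      by (intro nn_integral_mono) (auto intro: ennreal_leI split: split_indicator)
    also have "\<dots> < \<infinity>" by (simp add: ennreal_mult_eq_top_iff less_top[symmetric])
    finally have fin: "(\<integral>\<^sup>+x. ?h k x \<partial>M) < \<infinity>" .
    \<comment> \<open>The weight in front of \<open>q\<close> is measurable for \<open>F\<close>, so
      \<open>q\<close> can be replaced by its conditional expectation \<open>?e\<close>. This turns
      the linear term of the tangent bound into \<open>g / ?e\<close> on
      \<open>?N k\<close>.\<close>
    have "(\<integral>\<^sup>+x. ennreal (g x / (?e x)\<^sup>2) * indicator (?N k) x * ennreal (q x) \<partial>M)
        = (\<integral>\<^sup>+x. ennreal (g x / (?e x)\<^sup>2) * indicator (?N k) x * nn_cond_exp M F (\<lambda>x. ennreal (q x)) x \<partial>M)"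
      by (rule nn_cond_exp_intg[symmetric]) measurable
    also have "\<dots> = (\<integral>\<^sup>+x. ?h k x \<partial>M)"
    proof (rule nn_integral_cong_AE)
      have "AE x in M. ennreal (?e x) = nn_cond_exp M F (\<lambda>x. ennreal (q x)) x"
        using q q_pos by (intro ennreal_real_cond_exp) auto
      then show "AE x in M. ennreal (g x / (?e x)\<^sup>2) * indicator (?N k) x * nn_cond_exp M F (\<lambda>x. ennreal (q x)) x
          = ?h k x"
        using e_pos g
      proof eventually_elim
        case (elim x)
        have "ennreal (g x / (?e x)\<^sup>2) * ennreal (?e x) = ennreal (g x / ?e x)"
          using elim(2,3) by (simp add: ennreal_mult'[symmetric] power2_eq_square)
        then show ?case using elim(1) by (simp split: split_indicator)
      qed
    qed
    finally have tangent: "(\<integral>\<^sup>+x. ennreal (g x / (?e x)\<^sup>2) * indicator (?N k) x * ennreal (q x) \<partial>M)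
        = (\<integral>\<^sup>+x. ?h k x \<partial>M)" .
    have "(\<integral>\<^sup>+x. ?h k x \<partial>M) + (\<integral>\<^sup>+x. ?h k x \<partial>M) = (\<integral>\<^sup>+x. ?h k x + ?h k x \<partial>M)"
      by (rule nn_integral_add[symmetric]) measurable
    also have "\<dots> \<le> (\<integral>\<^sup>+x. ennreal (g x / q x) + ennreal (g x / (?e x)\<^sup>2) * indicator (?N k) x * ennreal (q x) \<partial>M)"
    proof (rule nn_integral_mono_AE)
      show "AE x in M. ?h k x + ?h k x
          \<le> ennreal (g x / q x) + ennreal (g x / (?e x)\<^sup>2) * indicator (?N k) x * ennreal (q x)"
        using e_pos g q_pos
      proof eventually_elim
        case (elim x)
        \<comment> \<open>This square is exactly \<open>g\<close> times the gap in the tangent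
          bound.\<close>
        have "0 \<le> g x * (?e x - q x)\<^sup>2 / (q x * (?e x)\<^sup>2)"
          using elim by simp
        also have "\<dots> = g x / q x + g x / (?e x)\<^sup>2 * q x - (g x / ?e x + g x / ?e x)"
          using elim by (simp add: field_simps power2_eq_square)
        finally have "g x / ?e x + g x / ?e x \<le> g x / q x + g x / (?e x)\<^sup>2 * q x" by simp
        then have "ennreal (g x / ?e x + g x / ?e x) \<le> ennreal (g x / q x + g x / (?e x)\<^sup>2 * q x)"
          by (rule ennreal_leI)
        moreover have "ennreal (g x / ?e x + g x / ?e x) = ennreal (g x / ?e x) + ennreal (g x / ?e x)"
          using elim by (intro ennreal_plus) auto
        moreover have "ennreal (g x / q x + g x / (?e x)\<^sup>2 * q x)
            = ennreal (g x / q x) + ennreal (g x / (?e x)\<^sup>2 * q x)"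
          using elim by (intro ennreal_plus) auto
        moreover have "ennreal (g x / (?e x)\<^sup>2 * q x) = ennreal (g x / (?e x)\<^sup>2) * ennreal (q x)"
          using elim by (intro ennreal_mult) auto
        ultimately have "ennreal (g x / ?e x) + ennreal (g x / ?e x)
            \<le> ennreal (g x / q x) + ennreal (g x / (?e x)\<^sup>2) * ennreal (q x)"
          by (simp only:)
        then show ?case by (simp split: split_indicator)
      qed
    qed
    also have "\<dots> = (\<integral>\<^sup>+x. ennreal (g x / q x) \<partial>M) + (\<integral>\<^sup>+x. ?h k x \<partial>M)"
      unfolding tangent[symmetric] by (rule nn_integral_add) measurable
    \<comment> \<open>One of the two copies of the truncated integral cancels; this is legitimate in
      the extended reals because \<open>fin\<close> makes it finite.\<close>
    finally show ?thesis
      using fin by (auto simp: ennreal_add_left_cancel_le add.commute)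
  qed
  \<comment> \<open>The truncation is removed by monotone convergence: \<open>g / ?e\<close> is
    real-valued, so every point lies in \<open>?N k\<close> for large \<open>k\<close>.\<close>
  have "incseq ?h"
    by (auto simp: incseq_def le_fun_def split: split_indicator)
  then have "(\<integral>\<^sup>+x. (SUP k. ?h k x) \<partial>M) = (SUP k. \<integral>\<^sup>+x. ?h k x \<partial>M)"
    by (intro nn_integral_monotone_convergence_SUP) measurable
  also have "\<dots> \<le> (\<integral>\<^sup>+x. ennreal (g x / q x) \<partial>M)"
    by (intro SUP_least bound)
  finally have le: "(\<integral>\<^sup>+x. (SUP k. ?h k x) \<partial>M) \<le> (\<integral>\<^sup>+x. ennreal (g x / q x) \<partial>M)" .
  have "(\<integral>\<^sup>+x. ennreal (g x / ?e x) \<partial>M) \<le> (\<integral>\<^sup>+x. (SUP k. ?h k x) \<partial>M)"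
  proof (rule nn_integral_mono)
    fix x assume "x \<in> space M"
    then have x: "x \<in> space F" using subalg by (simp add: subalgebra_def)
    obtain k :: nat where "g x / ?e x \<le> real k" using real_arch_simple by blast
    then have "ennreal (g x / ?e x) = ?h k x" using x by simp
    also have "\<dots> \<le> (SUP k. ?h k x)" by (rule SUP_upper) simp
    finally show "ennreal (g x / ?e x) \<le> (SUP k. ?h k x)" .
  qed
  with le show ?thesis by (rule order_trans[rotated])
qed

section \<open>Conditional second moments\<close>

lemma (in finite_measure) integrable_diff_const_power2:
  fixes Y :: "'a \<Rightarrow> real"
  assumes [measurable]: "Y \<in> borel_measurable M" and Y2: "integrable M (\<lambda>w. (Y w)\<^sup>2)"
  shows "integrable M (\<lambda>w. (Y w - c)\<^sup>2)"
proof -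
  have "integrable M Y" using Y2 by (rule square_integrable_imp_integrable[rotated]) simp
  then have "integrable M (\<lambda>w. (Y w)\<^sup>2 + ((- 2 * c) * Y w + c\<^sup>2))" using Y2 by simp
  then show ?thesis by (simp add: power2_diff algebra_simps)
qed

text \<open>Bias-variance decomposition given \<open>Z\<close>. With \<open>m\<close> the
  conditional mean, \<open>(Y - m)^2 = (Y - c)^2 + 2(c - m)Y + (m^2 - c^2)\<close>; conditioning
  replaces \<open>Y\<close> in the middle term by \<open>m\<close>, and the last two terms then sum
  to \<open>-(m - c)^2\<close>.\<close>

lemma (in prob_space) cond_var_given_plus_cond_bias:
  fixes Y :: "'a \<Rightarrow> real"
  assumes [measurable]: "Z \<in> borel_measurable M" "Y \<in> borel_measurable M"
    and Y2: "integrable M (\<lambda>w. (Y w)\<^sup>2)"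
  shows "AE w in M. cond_var_given M Z Y w + (cond_exp_given M Z Y w - c)\<^sup>2
    = cond_exp_given M Z (\<lambda>w. (Y w - c)\<^sup>2) w"
proof -
  let ?F = "sigma_of M Z"
  interpret sigma_finite_subalgebra M ?F
    by (rule sigma_finite_subalgebra_sigma_of) simp
  let ?m = "real_cond_exp M ?F Y"
  have Y1: "integrable M Y" using Y2 by (rule square_integrable_imp_integrable[rotated]) simp
  have Yc2: "integrable M (\<lambda>w. (Y w - c)\<^sup>2)" by (rule integrable_diff_const_power2) (use Y2 in auto)
  \<comment> \<open>Square integrability passes to the conditional mean by conditional Jensen for
    the convex function \<open>x^2\<close>; convexity follows from its increasing derivative
    \<open>2 * x\<close>.\<close>
  have m2: "integrable M (\<lambda>w. (?m w)\<^sup>2)"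
    by (rule integrable_convex_cond_exp[where I = UNIV])
       (use Y1 Y2 in \<open>auto intro!: convex_on_realI[where f' = "\<lambda>x. 2 * x"] derivative_eq_intros simp: emeasure_eq_measure\<close>)
  have mY: "integrable M (\<lambda>w. ?m w * Y w)"
  proof (rule Bochner_Integration.integrable_bound[OF Bochner_Integration.integrable_add[OF Y2 m2]])
    have "\<bar>a * b\<bar> \<le> \<bar>b\<^sup>2 + a\<^sup>2\<bar>" for a b :: real
    proof -
      have "2 * (\<bar>a\<bar> * \<bar>b\<bar>) \<le> a\<^sup>2 + b\<^sup>2" "0 \<le> \<bar>a\<bar> * \<bar>b\<bar>"
        using sum_squares_bound[of "\<bar>a\<bar>" "\<bar>b\<bar>"] by (simp_all add: mult.assoc)
      then show ?thesis unfolding abs_mult by linarith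
    qed
    then show "AE w in M. norm (?m w * Y w) \<le> norm ((Y w)\<^sup>2 + (?m w)\<^sup>2)" by simp
  qed simp
  let ?f = "\<lambda>w. 2 * (c - ?m w)"
  have fY: "integrable M (\<lambda>w. ?f w * Y w)"
  proof -
    have "integrable M (\<lambda>w. (2 * c) * Y w - 2 * (?m w * Y w))" using mY Y1 by simp
    then show ?thesis by (simp add: algebra_simps)
  qed
  have r: "integrable M (\<lambda>w. (?m w)\<^sup>2 - c\<^sup>2)" using m2 by simp
  have expand: "(\<lambda>w. (Y w - ?m w)\<^sup>2) = (\<lambda>w. (Y w - c)\<^sup>2 + (?f w * Y w + ((?m w)\<^sup>2 - c\<^sup>2)))"
    by (rule ext) (simp add: power2_eq_square algebra_simps)
  have "AE w in M. real_cond_exp M ?F (\<lambda>w. (Y w - c)\<^sup>2 + (?f w * Y w + ((?m w)\<^sup>2 - c\<^sup>2))) w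
      = real_cond_exp M ?F (\<lambda>w. (Y w - c)\<^sup>2) w + real_cond_exp M ?F (\<lambda>w. ?f w * Y w + ((?m w)\<^sup>2 - c\<^sup>2)) w"
    using Yc2 fY r by (intro real_cond_exp_add Bochner_Integration.integrable_add)
  moreover have "AE w in M. real_cond_exp M ?F (\<lambda>w. ?f w * Y w + ((?m w)\<^sup>2 - c\<^sup>2)) w
      = real_cond_exp M ?F (\<lambda>w. ?f w * Y w) w + real_cond_exp M ?F (\<lambda>w. (?m w)\<^sup>2 - c\<^sup>2) w"
    using fY r by (rule real_cond_exp_add)
  moreover have "AE w in M. real_cond_exp M ?F (\<lambda>w. ?f w * Y w) w = ?f w * ?m w"
    using fY by (intro real_cond_exp_mult) auto
  moreover have "AE w in M. real_cond_exp M ?F (\<lambda>w. (?m w)\<^sup>2 - c\<^sup>2) w = (?m w)\<^sup>2 - c\<^sup>2"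
    using r by (intro real_cond_exp_F_meas) auto
  ultimately show ?thesis
    unfolding cond_var_given_def cond_exp_given_def expand
    by eventually_elim (simp add: power2_eq_square algebra_simps)
qed

section \<open>Comparison of the two covariate sets, arm by arm\<close>

text \<open>Treats one arm: \<open>\<phi>\<close> selects an outcome from the pair \<open>V\<close>,
  \<open>q\<close> is the propensity or its complement, and \<open>e\<close> is any version of the
  conditional expectation of \<open>q\<close> given \<open>Z\<close>. Both numerators become the
  same function \<open>?g\<close>, measurable for the smaller sigma-algebra, and the Jensen bound
  compares the denominators.\<close>

lemma (in prob_space) nn_integral_weighted_cond_moment_le:
  fixes I :: "'a \<Rightarrow> 'i::second_countable_topology" and Z :: "'a \<Rightarrow> 'z::second_countable_topology"
    and \<phi> :: "'v::topological_space \<Rightarrow> real" and V :: "'a \<Rightarrow> 'v" and q e :: "'a \<Rightarrow> real"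
  defines "Y \<equiv> \<lambda>w. \<phi> (V w)"
  assumes ci: "cond_indep_given M V I Z" and [measurable]: "\<phi> \<in> borel_measurable borel"
    and Y2: "integrable M (\<lambda>w. (Y w)\<^sup>2)"
    and q: "integrable M q" "AE w in M. 0 < q w" and e: "AE w in M. e w = cond_exp_given M Z q w"
  shows "(\<integral>\<^sup>+w. ennreal ((cond_var_given M Z Y w + (cond_exp_given M Z Y w - c)\<^sup>2) / e w) \<partial>M)
    \<le> (\<integral>\<^sup>+w. ennreal ((cond_var_given M (\<lambda>w. (I w, Z w)) Y w
          + (cond_exp_given M (\<lambda>w. (I w, Z w)) Y w - c)\<^sup>2) / q w) \<partial>M)"
proof -
  have [measurable]: "V \<in> borel_measurable M" "I \<in> borel_measurable M" "Z \<in> borel_measurable M"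
    using ci by (auto simp: cond_indep_given_def)
  have [measurable]: "Y \<in> borel_measurable M" by (simp add: Y_def)
  interpret finite_measure_subalgebra M "sigma_of M Z"
    by unfold_locales (simp add: subalgebra_sigma_of)
  let ?g = "cond_exp_given M Z (\<lambda>w. (Y w - c)\<^sup>2)"
  have "AE w in M. cond_var_given M Z Y w + (cond_exp_given M Z Y w - c)\<^sup>2 = ?g w"
    using Y2 by (intro cond_var_given_plus_cond_bias) auto
  then have "(\<integral>\<^sup>+w. ennreal ((cond_var_given M Z Y w + (cond_exp_given M Z Y w - c)\<^sup>2) / e w) \<partial>M)
      = (\<integral>\<^sup>+w. ennreal (?g w / cond_exp_given M Z q w) \<partial>M)"
    using e by (intro nn_integral_cong_AE) auto
  also have "\<dots> \<le> (\<integral>\<^sup>+w. ennreal (?g w / q w) \<partial>M)"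
    unfolding cond_exp_given_def
    by (intro nn_integral_div_cond_exp_le real_cond_exp_pos q) auto
  also have "\<dots> = (\<integral>\<^sup>+w. ennreal ((cond_var_given M (\<lambda>w. (I w, Z w)) Y w
          + (cond_exp_given M (\<lambda>w. (I w, Z w)) Y w - c)\<^sup>2) / q w) \<partial>M)"
  proof (rule nn_integral_cong_AE)
    have "AE w in M. cond_var_given M (\<lambda>w. (I w, Z w)) Y w + (cond_exp_given M (\<lambda>w. (I w, Z w)) Y w - c)\<^sup>2
        = cond_exp_given M (\<lambda>w. (I w, Z w)) (\<lambda>w. (Y w - c)\<^sup>2) w"
      using Y2 by (intro cond_var_given_plus_cond_bias) auto
    moreover have "AE w in M. cond_exp_given M (\<lambda>w. (I w, Z w)) (\<lambda>w. (Y w - c)\<^sup>2) w = ?g w"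
      unfolding Y_def
      using cond_exp_given_drop_cond_indep[OF ci, of "\<lambda>v. (\<phi> v - c)\<^sup>2"] by simp
    ultimately show "AE w in M. ennreal (?g w / q w)
        = ennreal ((cond_var_given M (\<lambda>w. (I w, Z w)) Y w
          + (cond_exp_given M (\<lambda>w. (I w, Z w)) Y w - c)\<^sup>2) / q w)"
      by eventually_elim simp
  qed
  finally show ?thesis .
qed

theorem theorem6:
  fixes M :: "'w measure"
    and YT YC D :: "'w \<Rightarrow> real"
    and I :: "'w \<Rightarrow> 'i::euclidean_space"
    and U :: "'w \<Rightarrow> 'u::euclidean_space"
    and C :: "'w \<Rightarrow> 'c::euclidean_space"
    and X :: "'w \<Rightarrow> 'i \<times> 'u \<times> 'c"
    and X1 :: "'w \<Rightarrow> 'u \<times> 'c"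
  assumes "prob_space M"
    and "YT \<in> borel_measurable M" and "integrable M (\<lambda>w. (YT w)\<^sup>2)"
    and "YC \<in> borel_measurable M" and "integrable M (\<lambda>w. (YC w)\<^sup>2)"
    and "D \<in> borel_measurable M" and "\<forall>w\<in>space M. D w \<in> {0, 1}"
    and "I \<in> borel_measurable M" and "U \<in> borel_measurable M" and "C \<in> borel_measurable M"
    and X: "X = (\<lambda>w. (I w, U w, C w))"
    and X1: "X1 = (\<lambda>w. (U w, C w))"
    and unconfounded: "cond_indep_given M (\<lambda>w. (YT w, YC w)) D X"
    and overlap: "AE w in M. 0 < propensity M D X w \<and> propensity M D X w < 1"
    and instrument: "cond_indep_given M (\<lambda>w. (YT w, YC w)) I X1"
  shows "(\<integral>\<^sup>+w. ennreal (
            (cond_var_given M X1 YT w + (cond_exp_given M X1 YT w)\<^sup>2) / propensity M D X1 w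
          + (cond_var_given M X1 YC w + (cond_exp_given M X1 YC w)\<^sup>2) / (1 - propensity M D X1 w)) \<partial>M)
       \<le> (\<integral>\<^sup>+w. ennreal (
            (cond_var_given M X YT w + (cond_exp_given M X YT w)\<^sup>2) / propensity M D X w
          + (cond_var_given M X YC w + (cond_exp_given M X YC w)\<^sup>2) / (1 - propensity M D X w)) \<partial>M)
    \<and> (\<integral>\<^sup>+w. ennreal (
            (cond_var_given M X1 YT w + (cond_exp_given M X1 YT w - (\<integral>w. YT w \<partial>M))\<^sup>2) / propensity M D X1 w
          + (cond_var_given M X1 YC w + (cond_exp_given M X1 YC w - (\<integral>w. YC w \<partial>M))\<^sup>2) / (1 - propensity M D X1 w)) \<partial>M)
       \<le> (\<integral>\<^sup>+w. ennreal (
            (cond_var_given M X YT w + (cond_exp_given M X YT w - (\<integral>w. YT w \<partial>M))\<^sup>2) / propensity M D X w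
          + (cond_var_given M X YC w + (cond_exp_given M X YC w - (\<integral>w. YC w \<partial>M))\<^sup>2) / (1 - propensity M D X w)) \<partial>M)"
proof -
  interpret prob_space M by fact
  note [measurable] = assms(2,4,6,8-10)
  have X1_meas [measurable]: "X1 \<in> borel_measurable M" by (simp add: X1)
  have X': "X = (\<lambda>w. (I w, X1 w))" by (simp add: X X1)
  have X_meas [measurable]: "X \<in> borel_measurable M" by (simp add: X')
  interpret F: sigma_finite_subalgebra M "sigma_of M X"
    by (rule sigma_finite_subalgebra_sigma_of) simp
  interpret G: sigma_finite_subalgebra M "sigma_of M X1"
    by (rule sigma_finite_subalgebra_sigma_of) simp
  let ?p = "propensity M D X" and ?p1 = "propensity M D X1"
  let ?D = "indicator {w \<in> space M. D w = 1} :: 'w \<Rightarrow> real"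
  have D: "integrable M ?D" by (simp add: emeasure_eq_measure)
  have p: "integrable M ?p"
    unfolding propensity_def cond_prob_given_def cond_exp_given_def
    using D by (rule F.real_cond_exp_int)
  \<comment> \<open>Tower property: both propensities condition the same indicator, and the
    sigma-algebra of \<open>X1\<close> is contained in that of \<open>X\<close>.\<close>
  have p1: "AE w in M. ?p1 w = cond_exp_given M X1 ?p w"
    unfolding propensity_def cond_prob_given_def cond_exp_given_def
    by (rule AE_symmetric, rule G.real_cond_exp_nested_subalg)
       (use D subalgebra_sigma_of[OF X_meas] in \<open>auto simp: X' subalgebra_sigma_of_snd\<close>)
  have "AE w in M. cond_exp_given M X1 (\<lambda>w. 1 - ?p w) w
      = real_cond_exp M (sigma_of M X1) (\<lambda>_. 1) w - cond_exp_given M X1 ?p w"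
    unfolding cond_exp_given_def using p by (intro G.real_cond_exp_diff) auto
  moreover have "AE w in M. real_cond_exp M (sigma_of M X1) (\<lambda>_. 1) w = 1"
    by (rule G.real_cond_exp_F_meas) auto
  ultimately have q1: "AE w in M. 1 - ?p1 w = cond_exp_given M X1 (\<lambda>w. 1 - ?p w) w"
    using p1 by eventually_elim simp
  have p_pos: "AE w in M. 0 < ?p w" and q_pos: "AE w in M. 0 < 1 - ?p w"
    using overlap by auto
  \<comment> \<open>Overlap is inherited by \<open>X1\<close>, as conditional expectation preserves
    strict positivity; the complement is handled in the same way.\<close>
  have p1_pos: "AE w in M. 0 < ?p1 w"
    using G.real_cond_exp_gr_c[OF p p_pos] p1 unfolding cond_exp_given_def by eventually_elim simp
  have "integrable M (\<lambda>w. 1 - ?p w)" using p by simp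
  from G.real_cond_exp_gr_c[OF this q_pos] q1
  have q1_pos: "AE w in M. 0 < 1 - ?p1 w" unfolding cond_exp_given_def by eventually_elim simp
  have nonneg: "AE w in M. 0 \<le> cond_var_given M Z Y w"
    if [measurable]: "Y \<in> borel_measurable M" "Z \<in> borel_measurable M"
    for Y and Z :: "'w \<Rightarrow> 'z::topological_space"
  proof -
    interpret Z: sigma_finite_subalgebra M "sigma_of M Z"
      by (rule sigma_finite_subalgebra_sigma_of) simp
    have [measurable]: "cond_exp_given M Z Y \<in> borel_measurable M" by (simp add: cond_exp_given_def)
    have "AE w in M. 0 \<le> real_cond_exp M (sigma_of M Z) (\<lambda>w. (Y w - cond_exp_given M Z Y w)\<^sup>2) w"
      by (rule Z.real_cond_exp_pos) auto
    then show ?thesis by (simp add: cond_var_given_def cond_exp_given_def)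
  qed
  \<comment> \<open>Separating the arms under \<open>ennreal\<close> relies on both summands being
    nonnegative almost everywhere, hence on \<open>nonneg\<close> and the positive
    denominators.\<close>
  have split: "(\<integral>\<^sup>+w. ennreal ((cond_var_given M Z YT w + (cond_exp_given M Z YT w - c)\<^sup>2) / a w
        + (cond_var_given M Z YC w + (cond_exp_given M Z YC w - d)\<^sup>2) / b w) \<partial>M)
      = (\<integral>\<^sup>+w. ennreal ((cond_var_given M Z YT w + (cond_exp_given M Z YT w - c)\<^sup>2) / a w) \<partial>M)
      + (\<integral>\<^sup>+w. ennreal ((cond_var_given M Z YC w + (cond_exp_given M Z YC w - d)\<^sup>2) / b w) \<partial>M)"
    if [measurable]: "Z \<in> borel_measurable M" "a \<in> borel_measurable M" "b \<in> borel_measurable M"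
      and pos: "AE w in M. 0 < a w" "AE w in M. 0 < b w"
    for Z :: "'w \<Rightarrow> 'z::topological_space" and a b c d
  proof -
    have [measurable]: "cond_exp_given M Z Y \<in> borel_measurable M"
        "cond_var_given M Z Y \<in> borel_measurable M" for Y
      by (simp_all add: cond_exp_given_def cond_var_given_def)
    have "AE w in M. ennreal ((cond_var_given M Z YT w + (cond_exp_given M Z YT w - c)\<^sup>2) / a w
        + (cond_var_given M Z YC w + (cond_exp_given M Z YC w - d)\<^sup>2) / b w)
      = ennreal ((cond_var_given M Z YT w + (cond_exp_given M Z YT w - c)\<^sup>2) / a w)
      + ennreal ((cond_var_given M Z YC w + (cond_exp_given M Z YC w - d)\<^sup>2) / b w)"
      using pos nonneg[of YT Z, OF assms(2) that(1)] nonneg[of YC Z, OF assms(4) that(1)]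
      by eventually_elim (simp add: ennreal_plus)
    then show ?thesis
      by (simp add: nn_integral_cong_AE nn_integral_add)
  qed
  have p_meas: "?p \<in> borel_measurable M" "?p1 \<in> borel_measurable M"
    "(\<lambda>w. 1 - ?p w) \<in> borel_measurable M" "(\<lambda>w. 1 - ?p1 w) \<in> borel_measurable M"
    by (simp_all add: propensity_def cond_prob_given_def cond_exp_given_def)
  have fst_meas: "fst \<in> borel_measurable (borel :: (real \<times> real) measure)"
    and snd_meas: "snd \<in> borel_measurable (borel :: (real \<times> real) measure)"
    by (intro borel_measurable_continuous_onI continuous_intros)+
  \<comment> \<open>Arbitrary centering constants serve both claims: \<open>c = d = 0\<close> gives
    the imputation inequality, and the two means give the IPW inequality.\<close>
  have main: "(\<integral>\<^sup>+w. ennreal ((cond_var_given M X1 YT w + (cond_exp_given M X1 YT w - c)\<^sup>2) / ?p1 w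
        + (cond_var_given M X1 YC w + (cond_exp_given M X1 YC w - d)\<^sup>2) / (1 - ?p1 w)) \<partial>M)
      \<le> (\<integral>\<^sup>+w. ennreal ((cond_var_given M X YT w + (cond_exp_given M X YT w - c)\<^sup>2) / ?p w
        + (cond_var_given M X YC w + (cond_exp_given M X YC w - d)\<^sup>2) / (1 - ?p w)) \<partial>M)" for c d
  proof -
    have "(\<integral>\<^sup>+w. ennreal ((cond_var_given M X1 YT w + (cond_exp_given M X1 YT w - c)\<^sup>2) / ?p1 w) \<partial>M)
      \<le> (\<integral>\<^sup>+w. ennreal ((cond_var_given M X YT w + (cond_exp_given M X YT w - c)\<^sup>2) / ?p w) \<partial>M)"
      using nn_integral_weighted_cond_moment_le[OF instrument, of fst ?p ?p1 c] fst_meas assms(3) p p_pos p1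
      by (simp add: X'[symmetric])
    moreover have "(\<integral>\<^sup>+w. ennreal ((cond_var_given M X1 YC w + (cond_exp_given M X1 YC w - d)\<^sup>2) / (1 - ?p1 w)) \<partial>M)
      \<le> (\<integral>\<^sup>+w. ennreal ((cond_var_given M X YC w + (cond_exp_given M X YC w - d)\<^sup>2) / (1 - ?p w)) \<partial>M)"
      using nn_integral_weighted_cond_moment_le[OF instrument, of snd "\<lambda>w. 1 - ?p w" "\<lambda>w. 1 - ?p1 w" d]
        snd_meas assms(5) p q_pos q1
      by (simp add: X'[symmetric])
    ultimately show ?thesis
      unfolding split[OF X1_meas p_meas(2,4) p1_pos q1_pos] split[OF X_meas p_meas(1,3) p_pos q_pos]
      by (rule add_mono)
  qed
  show ?thesis
    using main[of 0 0] main[of "\<integral>w. YT w \<partial>M" "\<integral>w. YC w \<partial>M"] by simp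
qed

end
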